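(* Assume that $u\in C^2(b_{X_i})$, $1\le i\le N$. Then $$(L^c\bar{u}^{up},\psi_i)-(L^cu,\psi_i)=r(\beta_{i,l})+O(h_i^4),$$ where $\bar{u}^{up}\in U_h$ is defined by $$\bar{u}^{up}(\mathbf{x})=\sum_{l=1}^3\bigl(1+\beta_{i,l}h_i^2\bigr)P_l^{up}(\mathbf{x})\,u(\mathbf{x}_{i_l}),$$ and $$r(\beta_{i,l})=\int_{b_{X_i}}\mathbf{b}\cdot\nabla\tilde{g}^{up}(\mathbf{x})\,d\mathbf{x}+h_i^2\sum_{l=1}^3\beta_{i,l}\Bigl(\nabla\lambda_l^{up}\cdot\int_{b_{X_i}}\mathbf{b}\,d\mathbf{x}\Bigr)u(\mathbf{x}_{i_l}).$$
   Context: Model problem: $\Omega\subset\mathbb{R}^2$ and $u=u(\mathbf{x})$, $\mathbf{x}=(x,y)$, is the solution of $-\nabla\cdot(\kappa\nabla u)+\mathbf{b}\cdot\nabla u=f$ in $\Omega$, $u=g$ on $\partial\Omega$, where $\kappa$ is a real, symmetric, strictly positive definite $2\times2$ diffusion tensor, $\mathbf{b}\in W^{1,\infty}(\Omega)^2$, $f\in L^2(\Omega)$, $g\in H^{1/2}(\partial\Omega)$. Mesh: $\Omega_h=\{E_k:1\le k\le M\}$ is a triangular partition of $\Omega$ with $N$ nodes $X_i$ (coordinates $\mathbf{x}_i$). The dual element (control volume) $b_{X_i}$ of a node $X_i$ is the union, over the triangles having $X_i$ as a vertex, of the sub-control volumes, i.e. the quadrilaterals whose vertices are $X_i$, the midpoints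 of the two edges of the triangle meeting at $X_i$, and the barycenter of the triangle. $h_i$ is the maximum length of all triangle edges in $b_{X_i}$. The trial space is $U_h=\{u_h\in C(\bar\Omega): u_h|_{E_k}\in\mathcal{P}_1(E_k)\ (1\le k\le M),\ u_h|_{\partial\Omega}=g\}$, where $\mathcal{P}_1$ denotes polynomials of degree at most one. Upwind volume: the upwind volume $D_i^{up}$ is the sub-control volume of $b_{X_i}$ intersected by a ray passing through the node $\mathbf{x}_i$ in the direction $-\mathbf{b}(\mathbf{x}_i)$, and $\tau_i^{up}$ is the triangle in which $D_i^{up}$ lies. Its vertices are $\mathbf{x}_{i_l}=(x_l,y_l)$, $l=1,2,3$, with $\mathbf{x}_{i_1}=\mathbf{x}_i$. $P_l^{up}=\lambda_l^{up}\in\mathcal{P}_1$ is the linear Lagrange interpolation basis function of $\tau_i^{up}$ at $\mathbf{x}_{i_l}$, extended as a linear polynomial to $b_{X_i}$. Perturbation coefficients: $\beta_{i,l}=\beta_{i,l}(u_{i_1},u_{i_2},\dots,u_{i_{m_i}})$, $l=1,2,3$, are (nonlinear) coefficients depending on nodal values $u_{i_1},\dots,u_{i_{m_i}}$; they do not depend on $\mathbf{x}$. The vector field $\nabla\tilde{g}^{up}$: for $\mathbf{x}=(x,y)\in b_{X_i}$, $$\nabla\tilde{g}^{up}(\mathbf{x})=\frac{u_{xx}(\mathbf{x}_i)}{2}\sum_{l=1}^3\nabla P_l^{up}(x_l-x)^2+\frac{u_{yy}(\mathbf{x}_i)}{2}\sum_{l=1}^3\nabla P_l^{up}(y_l-y)^2+u_{xy}(\mathbf{x}_i)\sum_{l=1}^3\nabla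 P_l^{up}(x_l-x)(y_l-y).$$ Convection operator: $\psi_i$ is the function equal to $1$ on $b_{X_i}$ and $0$ elsewhere, and $(L^cw,\psi_i):=(\mathbf{b}\cdot\nabla w,\psi_i)=\int_{b_{X_i}}\mathbf{b}\cdot\nabla w\,d\mathbf{x}$. $O(h_i^k)$ denotes a quantity bounded in absolute value by a constant times $h_i^k$.
   Formalization: With u only C^2 the O(h_i^4) constant is per mesh; a mesh-independent constant (false for C^2 alone, e.g. u=|x|^{5/2}) is proved for Lipschitz second derivatives and shape-regular meshes; u-bar is given by its formula, its membership in U_h (impossible in general) is dropped. *)

theory Defs
  imports "HOL-Analysis.Analysis"
begin

type_synonym pt = "real^2"

section \<open>The model problem\<close>

definition grad :: "(pt \<Rightarrow> real) \<Rightarrow> pt \<Rightarrow> pt" where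
  "grad f x = (THE D. GDERIV f x :> D)"

primrec Ck :: "nat \<Rightarrow> (pt \<Rightarrow> real) \<Rightarrow> bool" where
  "Ck 0 f \<longleftrightarrow> continuous_on UNIV f"
| "Ck (Suc k) f \<longleftrightarrow> (\<exists>G. (\<forall>x. GDERIV f x :> G x) \<and> (\<forall>j. Ck k (\<lambda>x. G x $ j)))"

definition test_function :: "pt set \<Rightarrow> (pt \<Rightarrow> real) \<Rightarrow> bool" where
  "test_function \<Omega> \<phi> \<longleftrightarrow>
     (\<forall>k. Ck k \<phi>) \<and> (\<exists>K. compact K \<and> K \<subseteq> \<Omega> \<and> (\<forall>x. x \<notin> K \<longrightarrow> \<phi> x = 0))"

definition L2 :: "pt set \<Rightarrow> (pt \<Rightarrow> real) \<Rightarrow> bool" where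
  "L2 \<Omega> f \<longleftrightarrow> set_borel_measurable lebesgue \<Omega> f \<and> set_integrable lebesgue \<Omega> (\<lambda>x. (f x)\<^sup>2)"

definition Linf :: "pt set \<Rightarrow> (pt \<Rightarrow> real) \<Rightarrow> bool" where
  "Linf \<Omega> f \<longleftrightarrow> set_borel_measurable lebesgue \<Omega> f \<and>
     (\<exists>M. AE x in lebesgue. x \<in> \<Omega> \<longrightarrow> \<bar>f x\<bar> \<le> M)"

definition weak_partial :: "pt set \<Rightarrow> (pt \<Rightarrow> real) \<Rightarrow> 2 \<Rightarrow> (pt \<Rightarrow> real) \<Rightarrow> bool" where
  "weak_partial \<Omega> f j w \<longleftrightarrow> (\<forall>\<phi>. test_function \<Omega> \<phi> \<longrightarrow>
     (LINT x:\<Omega>|lebesgue. f x * grad \<phi> x $ j) = - (LINT x:\<Omega>|lebesgue. w x * \<phi> x))"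

definition W1inf :: "pt set \<Rightarrow> (pt \<Rightarrow> real) \<Rightarrow> bool" where
  "W1inf \<Omega> f \<longleftrightarrow> Linf \<Omega> f \<and> (\<forall>j. \<exists>w. Linf \<Omega> w \<and> weak_partial \<Omega> f j w)"

text \<open>A constant symmetric positive definite tensor is the special case of a constant function
  \<open>\<kappa>\<close>.\<close>

definition diffusion_tensor :: "pt set \<Rightarrow> (pt \<Rightarrow> real^2^2) \<Rightarrow> bool" where
  "diffusion_tensor \<Omega> \<kappa> \<longleftrightarrow>
     (\<forall>j k. Linf \<Omega> (\<lambda>x. \<kappa> x $ j $ k)) \<and>
     (\<forall>x\<in>\<Omega>. transpose (\<kappa> x) = \<kappa> x) \<and>
     (\<exists>\<alpha>>0. \<forall>x\<in>\<Omega>. \<forall>v. \<alpha> * (v \<bullet> v) \<le> v \<bullet> (\<kappa> x *v v))"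

text \<open>Weak form of \<open>-div (\<kappa> grad u) + b \<bullet> grad u = f\<close> with Dirichlet data \<open>g\<close>. It is only used for
  functions \<open>u\<close> that are \<open>C\<^sup>2\<close> up to the boundary, so that the gradient is the classical one, the
  boundary condition is pointwise, and \<open>g\<close>, being the trace of \<open>u\<close>, is in \<open>H\<^sup>1\<^sup>/\<^sup>2\<close>.\<close>

definition solves ::
  "pt set \<Rightarrow> (pt \<Rightarrow> real^2^2) \<Rightarrow> (pt \<Rightarrow> pt) \<Rightarrow> (pt \<Rightarrow> real) \<Rightarrow> (pt \<Rightarrow> real) \<Rightarrow> (pt \<Rightarrow> real) \<Rightarrow> bool" where
  "solves \<Omega> \<kappa> b f g u \<longleftrightarrow>
     (\<forall>\<phi>. test_function \<Omega> \<phi> \<longrightarrow>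
        (LINT x:\<Omega>|lebesgue. (\<kappa> x *v grad u x) \<bullet> grad \<phi> x + (b x \<bullet> grad u x) * \<phi> x)
          = (LINT x:\<Omega>|lebesgue. f x * \<phi> x)) \<and>
     (\<forall>x\<in>frontier \<Omega>. u x = g x)"

text \<open>\<open>u\<close> is \<open>C\<^sup>2\<close> on the closed set \<open>S\<close> with gradient \<open>Du\<close> and Hessian \<open>D2u\<close>; one-sided derivatives
  are used at the boundary of \<open>S\<close>, since nodes may lie there.
  It is used for \<open>S = closure \<Omega>\<close>, the union of the closed control volumes of any mesh. \<open>D2u x $ j $ k\<close> is the \<open>k\<close>-th partial
  derivative of the \<open>j\<close>-th one.\<close>

definition C2_on :: "pt set \<Rightarrow> (pt \<Rightarrow> real) \<Rightarrow> (pt \<Rightarrow> pt) \<Rightarrow> (pt \<Rightarrow> real^2^2) \<Rightarrow> bool" where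
  "C2_on S u Du D2u \<longleftrightarrow>
     (\<forall>x\<in>S. (u has_derivative (\<lambda>h. h \<bullet> Du x)) (at x within S)) \<and>
     (\<forall>x\<in>S. (Du has_derivative (\<lambda>h. D2u x *v h)) (at x within S)) \<and>
     continuous_on S D2u"

section \<open>Triangulations and control volumes\<close>

text \<open>A triangle is represented by the set of its three vertices.\<close>

definition triangular_mesh :: "pt set \<Rightarrow> pt set set \<Rightarrow> bool" where
  "triangular_mesh \<Omega> T \<longleftrightarrow> finite T \<and>
     (\<forall>t\<in>T. card t = 3 \<and> \<not> affine_dependent t) \<and>
     (\<forall>s\<in>T. \<forall>t\<in>T. convex hull s \<inter> convex hull t = convex hull (s \<inter> t)) \<and>
     (\<Union>t\<in>T. convex hull t) = closure \<Omega>"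

definition shape_regular :: "real \<Rightarrow> pt set set \<Rightarrow> bool" where
  "shape_regular \<sigma> T \<longleftrightarrow> (\<forall>t\<in>T. \<exists>c r. 0 < r \<and> cball c r \<subseteq> convex hull t \<and>
     diameter (convex hull t) \<le> \<sigma> * r)"

definition sub_volume :: "pt set \<Rightarrow> pt \<Rightarrow> pt set" where
  "sub_volume t X =
     convex hull ({X} \<union> midpoint X ` (t - {X}) \<union> {(1/3) *\<^sub>R (\<Sum>v\<in>t. v)})"

definition dual :: "pt set set \<Rightarrow> pt \<Rightarrow> pt set" where
  "dual T X = (\<Union>t\<in>{t\<in>T. X \<in> t}. sub_volume t X)"

definition mesh_size :: "pt set set \<Rightarrow> pt \<Rightarrow> real" where
  "mesh_size T X = Max {dist p q |p q t. t \<in> T \<and> X \<in> t \<and> p \<in> t \<and> q \<in> t}"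

text \<open>\<open>t\<close> is an upwind triangle of the node \<open>X\<close>. The starting point \<open>X\<close> of the ray belongs to every
  sub-control volume and therefore does not count. There are two such triangles if the ray runs
  along an edge, and none if \<open>b X = 0\<close> or if the ray leaves the domain at a boundary node.\<close>

definition upwind_triangle :: "pt set set \<Rightarrow> (pt \<Rightarrow> pt) \<Rightarrow> pt \<Rightarrow> pt set \<Rightarrow> bool" where
  "upwind_triangle T b X t \<longleftrightarrow> t \<in> T \<and> X \<in> t \<and> b X \<noteq> 0 \<and>
     (\<exists>s>0. X - s *\<^sub>R b X \<in> sub_volume t X)"

section \<open>Upwind reconstruction\<close>

definition P1 :: "(pt \<Rightarrow> real) set" where
  "P1 = {\<lambda>x. a \<bullet> x + c |a c. True}"

definition lagrange :: "pt set \<Rightarrow> pt \<Rightarrow> pt \<Rightarrow> real" where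
  "lagrange t v = (THE p. p \<in> P1 \<and> (\<forall>w\<in>t. p w = (if w = v then 1 else 0)))"

text \<open>In the following, \<open>t\<close> is the upwind triangle of \<open>X\<close>, and the coefficients \<open>\<beta>\<close> and the sums
  over \<open>l\<close> are indexed by the vertices of \<open>t\<close>.\<close>

definition ubar ::
  "pt set set \<Rightarrow> (pt \<Rightarrow> real) \<Rightarrow> pt \<Rightarrow> pt set \<Rightarrow> (pt \<Rightarrow> real) \<Rightarrow> pt \<Rightarrow> real" where
  "ubar T u X t \<beta> x = (\<Sum>v\<in>t. (1 + \<beta> v * (mesh_size T X)\<^sup>2) * lagrange t v x * u v)"

definition grad_gtilde :: "(pt \<Rightarrow> real^2^2) \<Rightarrow> pt \<Rightarrow> pt set \<Rightarrow> pt \<Rightarrow> pt" where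
  "grad_gtilde D2u X t x =
     (D2u X $ 1 $ 1 / 2) *\<^sub>R (\<Sum>v\<in>t. (v $ 1 - x $ 1)\<^sup>2 *\<^sub>R grad (lagrange t v) x) +
     (D2u X $ 2 $ 2 / 2) *\<^sub>R (\<Sum>v\<in>t. (v $ 2 - x $ 2)\<^sup>2 *\<^sub>R grad (lagrange t v) x) +
     (D2u X $ 1 $ 2) *\<^sub>R (\<Sum>v\<in>t. ((v $ 1 - x $ 1) * (v $ 2 - x $ 2)) *\<^sub>R grad (lagrange t v) x)"

text \<open>\<open>(L\<^sup>c w, \<psi>\<^sub>X)\<close>, where \<open>\<psi>\<^sub>X\<close> is the indicator function of the control volume of \<open>X\<close>\<close>

definition Lc :: "pt set set \<Rightarrow> (pt \<Rightarrow> pt) \<Rightarrow> (pt \<Rightarrow> real) \<Rightarrow> pt \<Rightarrow> real" where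
  "Lc T b w X = (LINT x:dual T X|lebesgue. b x \<bullet> grad w x)"

text \<open>The gradient of \<open>lagrange t v\<close> is constant, so it may be evaluated at \<open>X\<close>.\<close>

definition remainder ::
  "pt set set \<Rightarrow> (pt \<Rightarrow> pt) \<Rightarrow> (pt \<Rightarrow> real) \<Rightarrow> (pt \<Rightarrow> real^2^2) \<Rightarrow> pt \<Rightarrow> pt set \<Rightarrow> (pt \<Rightarrow> real) \<Rightarrow> real" where
  "remainder T b u D2u X t \<beta> =
     (LINT x:dual T X|lebesgue. b x \<bullet> grad_gtilde D2u X t x) +
     (mesh_size T X)\<^sup>2 *
       (\<Sum>v\<in>t. \<beta> v * (grad (lagrange t v) X \<bullet> (LINT x:dual T X|lebesgue. b x)) * u v)"

end

theory Submission
  imports Defs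
begin

text \<open>
  The error splits as an integral over the control volume of \<open>X\<close>. The perturbed reconstruction is affine,
  so its gradient is the constant vector \<open>\<Sum>v. (1 + \<beta> v * h\<^sup>2) * u v * G v\<close> with \<open>G v\<close> the gradient of
  the Lagrange function of the vertex \<open>v\<close>. The part of this sum that carries \<open>\<beta>\<close> integrates exactly to the
  second term of \<open>remainder\<close>. Therefore, for every \<open>\<beta>\<close>, the quantity to be estimated is
  \<open>\<integral> b \<bullet> e\<close> with \<open>e x = (\<Sum>v. u v * G v) - Du x - grad_gtilde x\<close>
  (\<open>consistency_error_eq\<close>). Since it is independent of \<open>\<beta>\<close>, it takes only finitely many values on one
  mesh, which is the first claim.

  For the uniform claim, write \<open>H\<close> for the Hessian at \<open>X\<close>. Interpolation is exact on affine functions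
  (\<open>lagrange_reproduces_affine\<close>), and this reduces \<open>grad_gtilde x\<close> to
  \<open>(\<Sum>v. ((v - X) \<bullet> H (v - X) / 2) * G v) - H (x - X)\<close> (\<open>grad_gtilde_eq\<close>). Inserting the Taylor expansion
  \<open>u v = u X + (v - X) \<bullet> Du X + (v - X) \<bullet> H (v - X) / 2 + R v\<close>, the affine part contributes \<open>Du X\<close>, the
  quadratic parts cancel, and
  \<open>e x = (\<Sum>v. R v * G v) - (Du x - Du X - H (x - X))\<close>. For a Lipschitz Hessian the bracket is
  \<open>O(h\<^sup>2)\<close> and \<open>R v\<close> is cubic in the size of the upwind triangle (\<open>C2_on_taylor_gradient\<close>, \<open>C2_on_taylor\<close>),
  while \<open>G v\<close> is at most the inverse of the radius of an inscribed disc (\<open>norm_grad_lagrange_le\<close>). With shape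
  regularity \<open>e\<close> is \<open>O(h\<^sup>2)\<close> (\<open>upwind_gradient_error\<close>), and the area of the control volume supplies the
  other factor \<open>h\<^sup>2\<close>.

  Two regularity questions have to be settled on the way. The formula for \<open>grad_gtilde\<close> contains only one
  mixed derivative, so the Hessian must be symmetric, also at boundary nodes
  (\<open>C2_on_symmetric_hessian\<close>). And \<open>Lc\<close> is defined with the two-sided gradient of \<open>u\<close>, which agrees with the
  one-sided \<open>Du\<close> away from the frontier of the closed domain, hence almost everywhere (\<open>Lc_C2\<close>).
\<close>

section \<open>Lagrange basis functions of a triangle\<close>

lemma grad_eqI:
  assumes "GDERIV f x :> D"
  shows "grad f x = D"
  unfolding grad_def
proof (rule the_equality, rule assms)
  fix D' assume "GDERIV f x :> D'"
  with assms have "(\<lambda>h. h \<bullet> D') = (\<lambda>h. h \<bullet> D)"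
    unfolding gderiv_def by (rule has_derivative_unique[rotated])
  then have "h \<bullet> D' = h \<bullet> D" for h
    by (rule fun_cong)
  then show "D' = D"
    by (metis vector_eq_rdot inner_commute)
qed

lemma GDERIV_affine: "GDERIV (\<lambda>x. a \<bullet> x + c) x :> a"
  unfolding gderiv_def by (auto intro!: derivative_eq_intros simp: inner_commute)

lemma affine_form_eq_0:
  fixes a :: "'a::euclidean_space"
  assumes "affine hull t = UNIV" "\<And>w. w \<in> t \<Longrightarrow> a \<bullet> w + c = 0"
  shows "a = 0" "c = 0"
proof -
  have "affine hull t \<subseteq> {x. a \<bullet> x = - c}"
    using assms(2) by (intro hull_minimal affine_hyperplane) (auto simp: eq_neg_iff_add_eq_0)
  with assms(1) have *: "a \<bullet> x = - c" for x by auto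
  from *[of 0] show "c = 0" by simp
  with *[of a] show "a = 0" by simp
qed

text \<open>The differences \<open>x - w\<close> of the vertices to a fixed vertex \<open>w \<noteq> v\<close> are linearly independent, so their
  images under a linear functional can be prescribed: all zero except at \<open>v\<close>. Translating back by \<open>w\<close>
  gives the affine function.\<close>

lemma barycentric_coordinate_exists:
  fixes t :: "'a::euclidean_space set"
  assumes "\<not> affine_dependent t" "v \<in> t" "w \<in> t" "w \<noteq> v"
  shows "\<exists>a c. \<forall>x\<in>t. a \<bullet> x + c = (if x = v then 1 else 0 :: real)"
proof -
  have "independent ((\<lambda>x. - w + x) ` (t - {w}))"
    using assms(1,3) affine_dependent_iff_dependent2 by blast
  from linear_independent_extend[OF this, of "\<lambda>y. if y = - w + v then 1 else 0 :: real"]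
  obtain g :: "'a \<Rightarrow> real" where g: "linear g"
    "\<forall>y\<in>(\<lambda>x. - w + x) ` (t - {w}). g y = (if y = - w + v then 1 else 0)"
    by blast
  have ga: "g y = adjoint g 1 \<bullet> y" for y
    using adjoint_works[OF g(1), of y 1] by (simp add: inner_commute)
  have "adjoint g 1 \<bullet> x + - (adjoint g 1 \<bullet> w) = (if x = v then 1 else 0)" if "x \<in> t" for x
  proof (cases "x = w")
    case True then show ?thesis using assms(4) by simp
  next
    case False
    with that g(2) have "g (- w + x) = (if x = v then 1 else 0)"
      by simp
    then show ?thesis using ga[of "- w + x"] by (simp add: inner_diff_right)
  qed
  then show ?thesis by blast
qed

lemma triangle_affine_hull:
  fixes t :: "pt set"
  assumes "card t = 3" "\<not> affine_dependent t"
  shows "affine hull t = UNIV"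
  using affine_independent_span_eq[OF assms(2)] assms(1) by simp

text \<open>The description that defines \<open>lagrange t v\<close> is satisfied by exactly one function: existence is the
  previous construction, and two affine functions that agree on \<open>t\<close> agree on its affine hull, the plane.\<close>

lemma lagrange_affine:
  assumes t: "card t = 3" "\<not> affine_dependent t" and "v \<in> t"
  obtains a c where "lagrange t v = (\<lambda>x. a \<bullet> x + c)"
    and "\<And>w. w \<in> t \<Longrightarrow> lagrange t v w = (if w = v then 1 else 0)"
proof -
  let ?Q = "\<lambda>p. p \<in> P1 \<and> (\<forall>w\<in>t. p w = (if w = v then 1 else 0))"
  have "\<exists>w\<in>t. w \<noteq> v"
  proof (rule ccontr)
    assume "\<not> ?thesis"
    then have "t \<subseteq> {v}" by auto
    then have "card t \<le> 1" using card_mono[of "{v}" t] by simp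
    with t show False by simp
  qed
  then obtain a c where ac: "\<forall>x\<in>t. a \<bullet> x + c = (if x = v then 1 else 0 :: real)"
    using barycentric_coordinate_exists[OF t(2) \<open>v \<in> t\<close>] by metis
  have "?Q (lagrange t v)"
    unfolding lagrange_def
  proof (rule theI[where P = "?Q"])
    show "?Q (\<lambda>x. a \<bullet> x + c)" using ac by (auto simp: P1_def)
    fix p assume p: "?Q p"
    then obtain a' c' where p': "p = (\<lambda>x. a' \<bullet> x + c')" by (auto simp: P1_def)
    have "(a' - a) \<bullet> w + (c' - c) = 0" if "w \<in> t" for w
    proof -
      have "a' \<bullet> w + c' = a \<bullet> w + c" using p p' ac that by metis
      then show ?thesis by (simp add: inner_diff_left)
    qed
    then have "a' - a = 0" "c' - c = 0"
      using affine_form_eq_0[OF triangle_affine_hull[OF t], of "a' - a" "c' - c"] by auto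
    then show "p = (\<lambda>x. a \<bullet> x + c)" using p' by simp
  qed
  then show thesis using that by (auto simp: P1_def)
qed

lemma lagrange_vertex:
  assumes "card t = 3" "\<not> affine_dependent t" "v \<in> t" "w \<in> t"
  shows "lagrange t v w = (if w = v then 1 else 0)"
  by (rule lagrange_affine[OF assms(1-3)]) (use assms(4) in blast)

lemma lagrange_grad:
  assumes "card t = 3" "\<not> affine_dependent t" "v \<in> t"
  shows "GDERIV (lagrange t v) x :> grad (lagrange t v) y"
    and "lagrange t v x = grad (lagrange t v) y \<bullet> x + lagrange t v 0"
proof -
  obtain a c where l: "lagrange t v = (\<lambda>x. a \<bullet> x + c)"
    by (rule lagrange_affine[OF assms])
  show "GDERIV (lagrange t v) x :> grad (lagrange t v) y"
    "lagrange t v x = grad (lagrange t v) y \<bullet> x + lagrange t v 0"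
    unfolding l by (simp_all add: grad_eqI[OF GDERIV_affine] GDERIV_affine)
qed

text \<open>Linear interpolation is exact on affine functions, and this is the gradient of that identity. With
  \<open>a = 0\<close> it says that the basis gradients sum to zero.\<close>

lemma lagrange_reproduces_affine:
  fixes t :: "pt set"
  assumes t: "card t = 3" "\<not> affine_dependent t"
  shows "(\<Sum>v\<in>t. (a \<bullet> v + c) *\<^sub>R grad (lagrange t v) y) = a"
proof -
  let ?G = "\<lambda>v. grad (lagrange t v) y"
  have "finite t" using t(1) card.infinite by fastforce
  have "((\<Sum>v\<in>t. (a \<bullet> v + c) *\<^sub>R ?G v) - a) \<bullet> w +
      ((\<Sum>v\<in>t. (a \<bullet> v + c) * lagrange t v 0) - c) = 0" if "w \<in> t" for w
  proof -
    have "(\<Sum>v\<in>t. (a \<bullet> v + c) *\<^sub>R ?G v) \<bullet> w + (\<Sum>v\<in>t. (a \<bullet> v + c) * lagrange t v 0)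
        = (\<Sum>v\<in>t. (a \<bullet> v + c) * (?G v \<bullet> w + lagrange t v 0))"
      by (simp add: inner_sum_left sum.distrib[symmetric] distrib_left)
    also have "\<dots> = (\<Sum>v\<in>t. (a \<bullet> v + c) * lagrange t v w)"
      by (intro sum.cong refl) (simp add: lagrange_grad(2)[OF t, where x = w and y = y, symmetric])
    also have "\<dots> = (\<Sum>v\<in>t. if v = w then a \<bullet> v + c else 0)"
      using that by (intro sum.cong refl) (auto simp: lagrange_vertex[OF t])
    also have "\<dots> = a \<bullet> w + c" using \<open>finite t\<close> that by simp
    finally show ?thesis by (simp add: inner_diff_left)
  qed
  then have "(\<Sum>v\<in>t. (a \<bullet> v + c) *\<^sub>R ?G v) - a = 0"
    by (rule affine_form_eq_0(1)[OF triangle_affine_hull[OF t]])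
  then show ?thesis by simp
qed

text \<open>A basis function takes values in \<open>[0, 1]\<close> on the triangle. Moving from the centre to the rim of an
  inscribed disc in the direction of the gradient increases it by \<open>r\<close> times the norm of the
  gradient, and this increase cannot exceed 1.\<close>

lemma norm_grad_lagrange_le:
  assumes t: "card t = 3" "\<not> affine_dependent t" and "v \<in> t"
    and r: "0 < r" "cball c r \<subseteq> convex hull t"
  shows "norm (grad (lagrange t v) y) \<le> 1 / r"
proof (cases "grad (lagrange t v) y = 0")
  case False
  define a where "a = grad (lagrange t v) y"
  obtain k where lag: "\<And>x. lagrange t v x = a \<bullet> x + k"
    using that[OF lagrange_grad(2)[OF t \<open>v \<in> t\<close>, where y = y, folded a_def]]
    by blast
  define z where "z = c + (r / norm a) *\<^sub>R a"
  have "convex {x. 0 \<le> lagrange t v x \<and> lagrange t v x \<le> 1}"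
  proof -
    have "{x. 0 \<le> lagrange t v x \<and> lagrange t v x \<le> 1} =
      {x. a \<bullet> x \<ge> - k} \<inter> {x. a \<bullet> x \<le> 1 - k}"
      unfolding lag by auto
    then show ?thesis
      by (simp add: convex_Int convex_halfspace_ge convex_halfspace_le)
  qed
  moreover have "t \<subseteq> {x. 0 \<le> lagrange t v x \<and> lagrange t v x \<le> 1}"
    by (auto simp: lagrange_vertex[OF t \<open>v \<in> t\<close>])
  ultimately have hull: "convex hull t \<subseteq> {x. 0 \<le> lagrange t v x \<and> lagrange t v x \<le> 1}"
    by (rule hull_minimal[rotated])
  have "z \<in> cball c r" "c \<in> cball c r"
    using False r(1) by (auto simp: z_def dist_norm a_def)
  with hull r(2) have "lagrange t v z \<le> 1" "0 \<le> lagrange t v c" by blast+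
  then have "a \<bullet> (z - c) \<le> 1"
    by (simp add: lag inner_diff_right)
  also have "a \<bullet> (z - c) = r * norm a"
    using False by (simp add: z_def a_def power2_norm_eq_inner[symmetric] power2_eq_square)
  finally show ?thesis using r(1) by (simp add: a_def field_simps)
qed (use r in simp)

section \<open>Symmetry of the Hessian\<close>

text \<open>The mean value theorem in the direction \<open>i\<close> turns the second difference into a first
  difference of \<open>Du\<close> in the direction \<open>j\<close>, which the linearisation \<open>H\<close> of \<open>Du\<close> approximates.
  The second difference is symmetric in \<open>i\<close> and \<open>j\<close>, whereas its approximation
  \<open>i \<bullet> H j\<close> is not obviously so; this is the source of the symmetry of the Hessian.\<close>

lemma second_difference_bound:
  fixes u :: "'a::real_inner \<Rightarrow> real"
  assumes du: "\<And>z. dist z x < d \<Longrightarrow> GDERIV u z :> Du z"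
    and bd: "\<And>z. dist z x < d \<Longrightarrow> norm (Du z - Du x - H (z - x)) \<le> e * norm (z - x)"
    and H: "linear H" and s: "0 < s" "s * (norm i + norm j) < d" and e: "0 \<le> e"
  shows "\<bar>u (x + s *\<^sub>R i + s *\<^sub>R j) - u (x + s *\<^sub>R i) - u (x + s *\<^sub>R j) + u x - s\<^sup>2 * (i \<bullet> H j)\<bar>
    \<le> 2 * e * s\<^sup>2 * (norm i + norm j)\<^sup>2"
proof -
  have near: "norm (q *\<^sub>R i + s' *\<^sub>R j) \<le> s * (norm i + norm j)"
    if "0 \<le> q" "q \<le> s" "0 \<le> s'" "s' \<le> s" for q s'
  proof -
    have "norm (q *\<^sub>R i + s' *\<^sub>R j) \<le> q * norm i + s' * norm j"
      using norm_triangle_ineq[of "q *\<^sub>R i" "s' *\<^sub>R j"] that by simp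
    also have "\<dots> \<le> s * norm i + s * norm j"
      using that by (intro add_mono mult_right_mono) auto
    finally show ?thesis by (simp add: ring_distribs)
  qed
  have near': "dist (x + q *\<^sub>R i + s' *\<^sub>R j) x < d"
    if "0 \<le> q" "q \<le> s" "0 \<le> s'" "s' \<le> s" for q s'
    using near[OF that] s(2) by (simp add: dist_norm add.assoc)
  define \<psi> where "\<psi> q = u (x + q *\<^sub>R i + s *\<^sub>R j) - u (x + q *\<^sub>R i)" for q
  have d\<psi>: "(\<psi> has_real_derivative (i \<bullet> (Du (x + q *\<^sub>R i + s *\<^sub>R j) - Du (x + q *\<^sub>R i)))) (at q)"
    if "0 \<le> q" "q \<le> s" for q
  proof -
    have chain: "((\<lambda>q. u (p + q *\<^sub>R i)) has_real_derivative (i \<bullet> D)) (at q)"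
      if "GDERIV u (p + q *\<^sub>R i) :> D" for p D
    proof -
      have "((\<lambda>q. p + q *\<^sub>R i) has_derivative (\<lambda>h. h *\<^sub>R i)) (at q)"
        by (auto intro!: derivative_eq_intros)
      from has_derivative_compose[OF this that[unfolded gderiv_def]] show ?thesis
        by (simp add: has_field_derivative_def mult_commute_abs)
    qed
    have "((\<lambda>q. u (x + s *\<^sub>R j + q *\<^sub>R i) - u (x + q *\<^sub>R i)) has_real_derivative
        (i \<bullet> Du (x + q *\<^sub>R i + s *\<^sub>R j) - i \<bullet> Du (x + q *\<^sub>R i))) (at q)"
      using du[OF near'[of q s]] du[OF near'[of q 0]] that s(1)
      by (intro DERIV_diff chain) (auto simp: add_ac)
    then show ?thesis
      by (simp add: \<psi>_def [abs_def] inner_diff_right add_ac)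
  qed
  obtain q where q: "0 < q" "q < s"
    "\<psi> s - \<psi> 0 = s * (i \<bullet> (Du (x + q *\<^sub>R i + s *\<^sub>R j) - Du (x + q *\<^sub>R i)))"
    using MVT2[OF s(1) d\<psi>] by auto
  define R where "R z = Du z - Du x - H (z - x)" for z
  have R: "norm (R (x + q *\<^sub>R i + s' *\<^sub>R j)) \<le> e * (s * (norm i + norm j))"
    if "0 \<le> s'" "s' \<le> s" for s'
  proof -
    have "norm (R (x + q *\<^sub>R i + s' *\<^sub>R j)) \<le> e * norm (x + q *\<^sub>R i + s' *\<^sub>R j - x)"
      unfolding R_def using near'[of q s'] that q by (intro bd) auto
    also have "\<dots> \<le> e * (s * (norm i + norm j))"
      using near[of q s'] that q e by (intro mult_left_mono) (auto simp: add.assoc)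
    finally show ?thesis .
  qed
  have "Du (x + q *\<^sub>R i + s *\<^sub>R j) - Du (x + q *\<^sub>R i)
      = R (x + q *\<^sub>R i + s *\<^sub>R j) - R (x + q *\<^sub>R i + 0 *\<^sub>R j) + s *\<^sub>R H j"
    by (simp add: R_def linear_add[OF H] linear_scale[OF H] add.assoc)
  with q(3) have "\<psi> s - \<psi> 0 = s * (i \<bullet>
      (R (x + q *\<^sub>R i + s *\<^sub>R j) - R (x + q *\<^sub>R i + 0 *\<^sub>R j) + s *\<^sub>R H j))"
    by simp
  then have "\<psi> s - \<psi> 0 - s\<^sup>2 * (i \<bullet> H j)
      = s * (i \<bullet> (R (x + q *\<^sub>R i + s *\<^sub>R j) - R (x + q *\<^sub>R i + 0 *\<^sub>R j)))"
    by (simp add: inner_add_right power2_eq_square algebra_simps)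
  also have "\<bar>\<dots>\<bar> \<le> s * (norm i * (2 * (e * (s * (norm i + norm j)))))"
  proof -
    have "norm (R (x + q *\<^sub>R i + s *\<^sub>R j) - R (x + q *\<^sub>R i + 0 *\<^sub>R j)) \<le>
        2 * (e * (s * (norm i + norm j)))"
      using norm_triangle_ineq4[of "R (x + q *\<^sub>R i + s *\<^sub>R j)" "R (x + q *\<^sub>R i + 0 *\<^sub>R j)"]
        R[of s] R[of 0] s(1) by linarith
    then have "\<bar>i \<bullet> (R (x + q *\<^sub>R i + s *\<^sub>R j) - R (x + q *\<^sub>R i + 0 *\<^sub>R j))\<bar>
        \<le> norm i * (2 * (e * (s * (norm i + norm j))))"
      by (intro order_trans[OF Cauchy_Schwarz_ineq2] mult_left_mono) auto
    then show ?thesis using s(1) by (simp add: abs_mult)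
  qed
  also have "\<dots> = (2 * e * s\<^sup>2 * (norm i + norm j)) * norm i"
    by (simp add: power2_eq_square)
  also have "\<dots> \<le> (2 * e * s\<^sup>2 * (norm i + norm j)) * (norm i + norm j)"
    using e by (intro mult_left_mono) auto
  also have "\<dots> = 2 * e * s\<^sup>2 * (norm i + norm j)\<^sup>2"
    by (simp add: power2_eq_square)
  finally show ?thesis by (simp add: \<psi>_def algebra_simps)
qed

text \<open>Schwarz's theorem, for a gradient that is differentiable at the single point \<open>x\<close>: both
  \<open>i \<bullet> H j\<close> and \<open>j \<bullet> H i\<close> are limits of the same second difference quotient.\<close>

lemma second_derivative_symmetric:
  fixes u :: "'a::real_inner \<Rightarrow> real"
  assumes G: "open G" "x \<in> G" and du: "\<And>z. z \<in> G \<Longrightarrow> GDERIV u z :> Du z"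
    and d2: "(Du has_derivative H) (at x)"
  shows "i \<bullet> H j = j \<bullet> H i"
proof -
  have H: "linear H" using d2 by (rule has_derivative_linear)
  define n where "n = (norm i + norm j)\<^sup>2"
  have *: "\<bar>i \<bullet> H j - j \<bullet> H i\<bar> \<le> 4 * e * n" if "e > 0" for e
  proof -
    obtain d1 where d1: "d1 > 0" "ball x d1 \<subseteq> G" using G openE by blast
    obtain d2 where d2: "d2 > 0" "\<And>z. norm (z - x) < d2 \<Longrightarrow>
        norm (Du z - Du x - H (z - x)) \<le> e * norm (z - x)"
      using d2 \<open>e > 0\<close> unfolding has_derivative_at_alt by metis
    define d where "d = min d1 d2"
    have "d > 0" using d1 d2 by (simp add: d_def)
    \<comment> \<open>The summand 1 makes the step strictly admissible and covers \<open>i = j = 0\<close>.\<close>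
    define s where "s = d / (norm i + norm j + 1)"
    have s0: "0 < s" using \<open>d > 0\<close> by (simp add: s_def add_nonneg_pos)
    have s1: "s * (norm i + norm j) < d"
    proof -
      have "s * (norm i + norm j) < s * (norm i + norm j + 1)" using s0 by simp
      also have "\<dots> = d" by (simp add: s_def add_nonneg_eq_0_iff)
      finally show ?thesis .
    qed
    have A: "dist z x < d \<Longrightarrow> GDERIV u z :> Du z" for z
      using d1 du by (auto simp: d_def dist_commute subset_eq)
    have B: "dist z x < d \<Longrightarrow> norm (Du z - Du x - H (z - x)) \<le> e * norm (z - x)" for z
      using d2 by (auto simp: d_def dist_norm)
    define \<Delta> where "\<Delta> = u (x + s *\<^sub>R i + s *\<^sub>R j) - u (x + s *\<^sub>R i) - u (x + s *\<^sub>R j) + u x"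
    have "\<bar>\<Delta> - s\<^sup>2 * (i \<bullet> H j)\<bar> \<le> 2 * e * s\<^sup>2 * n"
      unfolding \<Delta>_def n_def using second_difference_bound[OF A B H s0 s1] \<open>e > 0\<close> by simp
    moreover have "\<bar>\<Delta> - s\<^sup>2 * (j \<bullet> H i)\<bar> \<le> 2 * e * s\<^sup>2 * n"
      using second_difference_bound[OF A B H s0, where i = j and j = i] s1 \<open>e > 0\<close>
      by (simp add: \<Delta>_def n_def algebra_simps)
    ultimately have "\<bar>s\<^sup>2 * (i \<bullet> H j) - s\<^sup>2 * (j \<bullet> H i)\<bar> \<le> s\<^sup>2 * (4 * e * n)"
      by (simp add: abs_le_iff) argo
    then have "s\<^sup>2 * \<bar>i \<bullet> H j - j \<bullet> H i\<bar> \<le> s\<^sup>2 * (4 * e * n)"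
      by (simp add: abs_mult right_diff_distrib[symmetric])
    then show ?thesis using s0 by simp
  qed
  have "\<bar>i \<bullet> H j - j \<bullet> H i\<bar> \<le> 0"
  proof (rule field_le_epsilon)
    fix e :: real assume "e > 0"
    have n: "0 \<le> n" by (simp add: n_def)
    have "\<bar>i \<bullet> H j - j \<bullet> H i\<bar> \<le> 4 * (e / (4 * (n + 1))) * n"
      using \<open>e > 0\<close> n by (intro *) auto
    also have "\<dots> = e * (n / (n + 1))" using n by (simp add: field_simps)
    also have "\<dots> \<le> e * 1" using \<open>e > 0\<close> n by (intro mult_left_mono) auto
    finally show "\<bar>i \<bullet> H j - j \<bullet> H i\<bar> \<le> 0 + e" by simp
  qed
  then show ?thesis by simp
qed

text \<open>On the open set this is Schwarz's theorem. A node may lie on the boundary, where only one-sided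
  derivatives exist; there the symmetry follows by continuity of the Hessian.\<close>

lemma C2_on_symmetric_hessian:
  assumes "open \<Omega>" and C2: "C2_on (closure \<Omega>) u Du D2u" and x: "x \<in> closure \<Omega>"
  shows "transpose (D2u x) = D2u x"
proof -
  have eq: "D2u z $ i $ j - D2u z $ j $ i = 0" if "z \<in> \<Omega>" for z i j
  proof -
    have at: "at y within closure \<Omega> = at y" if "y \<in> \<Omega>" for y
      using that \<open>open \<Omega>\<close> by (meson at_within_interior closure_subset interior_maximal subsetD)
    have "GDERIV u y :> Du y" if y: "y \<in> \<Omega>" for y
    proof -
      have "y \<in> closure \<Omega>" using y closure_subset by blast
      then have "(u has_derivative (\<lambda>h. h \<bullet> Du y)) (at y within closure \<Omega>)"
        using C2 by (simp add: C2_on_def)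
      then show ?thesis unfolding at[OF y] gderiv_def .
    qed
    moreover have "(Du has_derivative (*v) (D2u z)) (at z)"
    proof -
      have "z \<in> closure \<Omega>" using that closure_subset by blast
      then have "(Du has_derivative (*v) (D2u z)) (at z within closure \<Omega>)"
        using C2 by (simp add: C2_on_def)
      then show ?thesis unfolding at[OF that] .
    qed
    ultimately have "axis i 1 \<bullet> (D2u z *v axis j 1) = axis j 1 \<bullet> (D2u z *v axis i 1)"
      by (rule second_derivative_symmetric[OF \<open>open \<Omega>\<close> that])
    then show ?thesis
      by (simp add: inner_axis' matrix_vector_mul_component inner_axis)
  qed
  have cont: "continuous_on (closure \<Omega>) (\<lambda>z. D2u z $ i $ j - D2u z $ j $ i)" for i j
    using C2 by (auto simp: C2_on_def intro!: continuous_intros)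
  have "D2u x $ i $ j - D2u x $ j $ i = 0" for i j
    by (rule continuous_constant_on_closure[OF cont eq x])
  then show ?thesis
    unfolding transpose_def vec_eq_iff vec_lambda_beta by (metis eq_iff_diff_eq_0)
qed

section \<open>Taylor expansion along segments\<close>

lemma norm_matrix_vector_mult_le: "norm (A *v x) \<le> norm A * norm x"
  for A :: "real^'n^'m"
proof -
  have "norm (A *v x) = L2_set (\<lambda>i. \<bar>A $ i \<bullet> x\<bar>) UNIV"
    by (simp add: norm_vec_def matrix_vector_mul_component)
  also have "\<dots> \<le> L2_set (\<lambda>i. norm (A $ i) * norm x) UNIV"
    by (intro L2_set_mono) (auto simp: Cauchy_Schwarz_ineq2)
  also have "\<dots> = norm A * norm x"
    by (simp add: norm_vec_def L2_set_left_distrib)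
  finally show ?thesis .
qed

text \<open>The remainder \<open>z \<mapsto> Du z - Du x - D2u x *v (z - x)\<close> has derivative \<open>D2u z - D2u x\<close>,
  which is at most \<open>L * norm (y - x)\<close> on the segment. One-sided derivatives on \<open>S\<close> suffice for
  the mean value inequality, because they restrict to derivatives within the segment.\<close>

lemma C2_on_taylor_gradient:
  assumes C2: "C2_on S u Du D2u" and L: "L-lipschitz_on S D2u"
    and seg: "closed_segment x y \<subseteq> S"
  shows "norm (Du y - Du x - D2u x *v (y - x)) \<le> L * norm (y - x) ^ 2"
proof -
  let ?f = "\<lambda>z. Du z - Du x - D2u x *v (z - x)"
  have "norm (?f y - ?f x) \<le> (L * norm (y - x)) * norm (y - x)"
  proof (rule differentiable_bound[OF convex_closed_segment])
    fix z assume z: "z \<in> closed_segment x y"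
    have "(Du has_derivative (*v) (D2u z)) (at z within closed_segment x y)"
      using C2 seg z by (auto simp: C2_on_def intro: has_derivative_subset)
    moreover have "((\<lambda>z. D2u x *v (z - x)) has_derivative (*v) (D2u x)) (at z within closed_segment x y)"
      by (intro bounded_linear.has_derivative[OF matrix_vector_mul_bounded_linear, THEN has_derivative_eq_rhs]
        derivative_eq_intros) auto
    ultimately show "(?f has_derivative (\<lambda>h. (D2u z - D2u x) *v h)) (at z within closed_segment x y)"
      by (auto intro!: derivative_eq_intros simp: matrix_vector_mult_diff_rdistrib)
    have "norm (D2u z - D2u x) \<le> L * norm (z - x)"
      using lipschitz_onD[OF L, of z x] z seg by (auto simp: dist_norm)
    also have "\<dots> \<le> L * norm (y - x)"
      using lipschitz_on_nonneg[OF L] segment_bound1[OF z] by (auto intro: mult_left_mono)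
    finally show "onorm ((*v) (D2u z - D2u x)) \<le> L * norm (y - x)"
      by (intro onorm_le order_trans[OF norm_matrix_vector_mult_le] mult_right_mono) auto
  qed auto
  then show ?thesis by (simp add: power2_eq_square)
qed

lemma inner_symmetric_matrix:
  fixes A :: "real^'n^'n"
  assumes "transpose A = A"
  shows "p \<bullet> (A *v q) = q \<bullet> (A *v p)"
proof -
  have "p \<bullet> (A *v q) = (transpose A *v p) \<bullet> q"
    by (simp add: dot_lmul_matrix transpose_matrix_vector)
  then show ?thesis
    using assms by (simp add: inner_commute)
qed

text \<open>The remainder has gradient \<open>Du z - Du x - D2u x *v (z - x)\<close>, where the symmetry of the
  Hessian enters in differentiating the quadratic term. Hence \<open>C2_on_taylor_gradient\<close>, applied on the initial
  part of the segment, bounds this gradient.\<close>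

lemma C2_on_taylor:
  assumes C2: "C2_on S u Du D2u" and L: "L-lipschitz_on S D2u"
    and seg: "closed_segment x y \<subseteq> S" and sym: "transpose (D2u x) = D2u x"
  shows "\<bar>u y - u x - (y - x) \<bullet> Du x - ((y - x) \<bullet> (D2u x *v (y - x))) / 2\<bar> \<le> L * norm (y - x) ^ 3"
proof -
  let ?f = "\<lambda>z. u z - u x - (z - x) \<bullet> Du x - ((z - x) \<bullet> (D2u x *v (z - x))) / 2"
  let ?g = "\<lambda>z. Du z - Du x - D2u x *v (z - x)"
  have "norm (?f y - ?f x) \<le> (L * norm (y - x) ^ 2) * norm (y - x)"
  proof (rule differentiable_bound[OF convex_closed_segment])
    fix z assume z: "z \<in> closed_segment x y"
    have u: "(u has_derivative (\<lambda>h. h \<bullet> Du z)) (at z within closed_segment x y)"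
      using C2 seg z by (auto simp: C2_on_def intro: has_derivative_subset)
    have H: "((\<lambda>z. D2u x *v (z - x)) has_derivative (*v) (D2u x)) (at z within closed_segment x y)"
      by (intro bounded_linear.has_derivative[OF matrix_vector_mul_bounded_linear, THEN has_derivative_eq_rhs]
        derivative_eq_intros) auto
    note comm = inner_symmetric_matrix[OF sym]
    have id: "((\<lambda>z. z - x) has_derivative (\<lambda>h. h)) (at z within closed_segment x y)"
      by (auto intro!: derivative_eq_intros)
    have "((\<lambda>z. ((z - x) \<bullet> (D2u x *v (z - x))) / 2) has_derivative (\<lambda>h. h \<bullet> (D2u x *v (z - x))))
        (at z within closed_segment x y)"
      by (rule has_derivative_eq_rhs[OF bounded_linear.has_derivative[OF bounded_linear_divide has_derivative_inner[OF id H]]])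
        (rule ext, subst comm[of "z - x"], simp)
    moreover have "((\<lambda>z. u z - u x - (z - x) \<bullet> Du x) has_derivative (\<lambda>h. h \<bullet> Du z - h \<bullet> Du x))
        (at z within closed_segment x y)"
      by (rule has_derivative_eq_rhs[OF has_derivative_diff[OF has_derivative_diff[OF u
          has_derivative_const] has_derivative_inner_left[OF id]]]) simp
    ultimately show "(?f has_derivative (\<lambda>h. h \<bullet> ?g z)) (at z within closed_segment x y)"
      unfolding inner_diff_right by (rule has_derivative_diff[rotated])
    have "closed_segment x z \<subseteq> S"
      using seg z by (meson ends_in_segment(1) order_trans subset_closed_segment)
    then have "norm (?g z) \<le> L * norm (z - x) ^ 2"
      by (rule C2_on_taylor_gradient[OF C2 L])
    also have "\<dots> \<le> L * norm (y - x) ^ 2"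
      using lipschitz_on_nonneg[OF L] segment_bound1[OF z] by (auto intro: mult_left_mono power_mono)
    finally have bound: "norm (?g z) \<le> L * norm (y - x) ^ 2" .
    show "onorm (\<lambda>h. h \<bullet> ?g z) \<le> L * norm (y - x) ^ 2"
    proof (rule onorm_le)
      fix h
      have "norm (h \<bullet> ?g z) \<le> norm (?g z) * norm h"
        using Cauchy_Schwarz_ineq2[of h "?g z"] by (simp add: mult.commute)
      also have "\<dots> \<le> L * norm (y - x) ^ 2 * norm h"
        using bound by (rule mult_right_mono) simp
      finally show "norm (h \<bullet> ?g z) \<le> L * norm (y - x) ^ 2 * norm h" .
    qed
  qed auto
  then show ?thesis by (simp add: power2_eq_square power3_eq_cube mult.assoc)
qed

section \<open>The quadratic correction\<close>

lemma quadratic_form_real2: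
  fixes A :: "real^2^2"
  assumes "transpose A = A"
  shows "w \<bullet> (A *v w) / 2 = A $ 1 $ 1 / 2 * (w $ 1)\<^sup>2 + A $ 2 $ 2 / 2 * (w $ 2)\<^sup>2 + A $ 1 $ 2 * (w $ 1 * w $ 2)"
proof -
  have "A $ 2 $ 1 = A $ 1 $ 2"
    using arg_cong[OF assms, of "\<lambda>M. M $ 1 $ 2"] by (simp add: transpose_def)
  then show ?thesis
    by (simp add: inner_vec_def matrix_vector_mult_def sum_2 power2_eq_square field_simps)
qed

text \<open>The sum in \<open>grad_gtilde\<close> is half the Hessian form at \<open>v - x\<close>, weighted with the basis
  gradients. Expanding \<open>v - x = (v - X) - (x - X)\<close>, the mixed term is affine in \<open>v\<close> and the last one is
  constant, so that exactness on affine functions evaluates both. The point \<open>x\<close> survives only in the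
  linear term \<open>D2u X *v (x - X)\<close>, which is the first-order change of \<open>Du\<close>.\<close>

lemma grad_gtilde_eq:
  assumes t: "card t = 3" "\<not> affine_dependent t" and sym: "transpose (D2u X) = D2u X"
  shows "grad_gtilde D2u X t x =
    (\<Sum>v\<in>t. ((v - X) \<bullet> (D2u X *v (v - X)) / 2) *\<^sub>R grad (lagrange t v) x) - D2u X *v (x - X)"
proof -
  let ?G = "\<lambda>v. grad (lagrange t v) x"
  define A where "A = D2u X"
  note symA = inner_symmetric_matrix[OF sym, folded A_def]
  have "grad_gtilde D2u X t x = (\<Sum>v\<in>t. ((v - x) \<bullet> (A *v (v - x)) / 2) *\<^sub>R ?G v)"
    using sym
    by (simp add: grad_gtilde_def A_def quadratic_form_real2 scaleR_sum_right scaleR_add_left sum.distrib)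
  \<comment> \<open>The subtracted coefficient is written as an affine function of \<open>v\<close> with gradient
    \<open>A *v (x - X)\<close>, the form in which the interpolation identity applies.\<close>
  also have "\<dots> = (\<Sum>v\<in>t. ((v - X) \<bullet> (A *v (v - X)) / 2) *\<^sub>R ?G v
      - ((A *v (x - X)) \<bullet> v + (- ((A *v (x - X)) \<bullet> X) - (x - X) \<bullet> (A *v (x - X)) / 2)) *\<^sub>R ?G v)"
  proof (intro sum.cong refl)
    fix v
    have "(v - x) \<bullet> (A *v (v - x)) = ((v - X) - (x - X)) \<bullet> (A *v ((v - X) - (x - X)))" by simp
    also have "\<dots> = (v - X) \<bullet> (A *v (v - X)) - 2 * ((A *v (x - X)) \<bullet> (v - X))
        + (x - X) \<bullet> (A *v (x - X))"
      unfolding matrix_vector_mult_diff_distrib inner_diff_left inner_diff_right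
      using symA[of "v - X" "x - X"]
      by (simp add: matrix_vector_mult_diff_distrib inner_diff_left inner_diff_right inner_commute)
    finally have "(v - x) \<bullet> (A *v (v - x)) / 2 = (v - X) \<bullet> (A *v (v - X)) / 2
        - ((A *v (x - X)) \<bullet> v + (- ((A *v (x - X)) \<bullet> X) - (x - X) \<bullet> (A *v (x - X)) / 2))"
      by (simp add: inner_diff_right field_simps)
    then show "((v - x) \<bullet> (A *v (v - x)) / 2) *\<^sub>R ?G v = ((v - X) \<bullet> (A *v (v - X)) / 2) *\<^sub>R ?G v
      - ((A *v (x - X)) \<bullet> v + (- ((A *v (x - X)) \<bullet> X) - (x - X) \<bullet> (A *v (x - X)) / 2)) *\<^sub>R ?G v"
      by (simp only: scaleR_diff_left)
  qed
  also have "\<dots> = (\<Sum>v\<in>t. ((v - X) \<bullet> (A *v (v - X)) / 2) *\<^sub>R ?G v) - A *v (x - X)"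
    by (simp only: sum_subtractf lagrange_reproduces_affine[OF t])
  finally show ?thesis by (simp add: A_def)
qed

section \<open>Control volumes of a triangular mesh\<close>

lemma sub_volume_subset_hull:
  assumes t: "card t = 3" and X: "X \<in> t"
  shows "sub_volume t X \<subseteq> convex hull t"
proof -
  have "finite t" using t card.infinite by fastforce
  have "midpoint X v \<in> convex hull t" if "v \<in> t" for v
    using that X hull_inc[of _ t convex] convex_convex_hull[of t]
    by (meson convex_contains_segment midpoint_in_closed_segment subsetD)
  moreover have "(\<Sum>v\<in>t. (1/3) *\<^sub>R v) \<in> convex hull t"
    using \<open>finite t\<close> t by (intro convex_sum) (auto intro: hull_inc)
  ultimately show ?thesis
    unfolding sub_volume_def using X
    by (intro hull_minimal) (auto simp: scaleR_sum_right intro: hull_inc)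
qed

lemma compact_dual:
  assumes "finite T" "\<And>t. t \<in> T \<Longrightarrow> finite t"
  shows "compact (dual T X)"
  unfolding dual_def sub_volume_def
  using assms by (intro compact_UN) (auto intro!: finite_imp_compact_convex_hull)

lemma dist_le_mesh_size:
  assumes T: "finite T" "\<And>t. t \<in> T \<Longrightarrow> finite t"
    and "t \<in> T" "X \<in> t" "p \<in> t" "q \<in> t"
  shows "dist p q \<le> mesh_size T X"
  unfolding mesh_size_def
proof (rule Max_ge)
  have "{dist p q |p q t. t \<in> T \<and> X \<in> t \<and> p \<in> t \<and> q \<in> t}
      \<subseteq> (\<Union>t\<in>T. (\<lambda>(p, q). dist p q) ` (t \<times> t))"
    by auto
  then show "finite {dist p q |p q t. t \<in> T \<and> X \<in> t \<and> p \<in> t \<and> q \<in> t}"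
    using T by (rule_tac finite_subset) auto
qed (use assms in blast)

lemma convex_hull_subset_cball_mesh_size:
  assumes "finite T" "\<And>t. t \<in> T \<Longrightarrow> finite t" "t \<in> T" "X \<in> t"
  shows "convex hull t \<subseteq> cball X (mesh_size T X)"
  using dist_le_mesh_size[OF assms assms(4)] by (intro hull_minimal) auto

context
  fixes \<Omega> :: "pt set" and T :: "pt set set"
  assumes mesh: "triangular_mesh \<Omega> T"
begin

lemma mesh_finite: "finite T" and mesh_triangle: "t \<in> T \<Longrightarrow> card t = 3" "t \<in> T \<Longrightarrow> \<not> affine_dependent t"
  and mesh_covers: "(\<Union>t\<in>T. convex hull t) = closure \<Omega>"
  using mesh by (auto simp: triangular_mesh_def)

lemma mesh_triangle_finite: "t \<in> T \<Longrightarrow> finite t"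
  using mesh_triangle(1) card.infinite by fastforce

lemma dual_subset_hulls: "dual T X \<subseteq> (\<Union>t\<in>{t\<in>T. X \<in> t}. convex hull t)"
  unfolding dual_def using sub_volume_subset_hull mesh_triangle(1) by blast

lemma dual_subset_closure: "dual T X \<subseteq> closure \<Omega>"
  using dual_subset_hulls mesh_covers by blast

lemma dual_subset_cball: "dual T X \<subseteq> cball X (mesh_size T X)"
  using dual_subset_hulls
    convex_hull_subset_cball_mesh_size[OF mesh_finite mesh_triangle_finite] by blast

lemma compact_dual_mesh: "compact (dual T X)"
  using mesh_finite mesh_triangle_finite by (rule compact_dual)

lemma segment_in_closure:
  assumes "t \<in> T" "X \<in> convex hull t" "x \<in> convex hull t"
  shows "closed_segment X x \<subseteq> closure \<Omega>"
proof -
  have "closed_segment X x \<subseteq> convex hull t"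
    using assms convex_convex_hull by (meson convex_contains_segment)
  with assms(1) show ?thesis using mesh_covers by blast
qed

lemma measure_dual_le: "measure lebesgue (dual T X) \<le> pi * mesh_size T X ^ 2"
  if "X \<in> \<Union>T"
proof -
  from that obtain t where "t \<in> T" "X \<in> t" by blast
  then have h: "0 \<le> mesh_size T X"
    using dist_le_mesh_size[OF mesh_finite mesh_triangle_finite, of t X X X] by simp
  have "measure lebesgue (dual T X) \<le> measure lebesgue (cball X (mesh_size T X))"
    by (intro measure_mono_fmeasurable dual_subset_cball lmeasurable_compact compact_cball
        fmeasurableD[OF lmeasurable_compact[OF compact_dual_mesh]])
  also have "\<dots> = pi * mesh_size T X ^ 2"
    using h by (simp add: content_cball_conv_ball circle_area)
  finally show ?thesis .
qed

text \<open>The frontier of \<open>\<Omega>\<close> itself can have positive area even when its closure is a polygon, for instance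
  if a fat Cantor set has been removed. The frontier of the closure is covered by the edges of the mesh.\<close>

lemma negligible_frontier_closure: "negligible (frontier (closure \<Omega>))"
proof (rule negligible_subset)
  show "negligible (\<Union>t\<in>T. frontier (convex hull t))"
    using mesh_finite by (intro negligible_Union) (auto intro: negligible_convex_frontier)
  show "frontier (closure \<Omega>) \<subseteq> (\<Union>t\<in>T. frontier (convex hull t))"
    using frontier_Union_subset[of "(\<lambda>t. convex hull t) ` T"] mesh_finite
    by (simp add: mesh_covers)
qed

section \<open>The consistency error as an integral\<close>

lemma set_integrable_continuous_compact:
  fixes f :: "'a::euclidean_space \<Rightarrow> 'b::euclidean_space"
  assumes "compact K" "continuous_on K f"
  shows "set_integrable lebesgue K f"
proof -
  have "integrable lborel (\<lambda>x. indicator K x *\<^sub>R f x)"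
    using assms by (rule borel_integrable_compact)
  then show ?thesis
    unfolding set_integrable_def by (subst integrable_completion) auto
qed

text \<open>\<open>Lc\<close> uses the two-sided gradient, which may fail to exist at boundary points. In the interior of the
  closure the one-sided derivatives are two-sided, and the remaining points are negligible.\<close>

lemma Lc_C2:
  assumes b: "continuous_on (closure \<Omega>) b" and C2: "C2_on (closure \<Omega>) u Du D2u"
  shows "Lc T b u X = (LINT x:dual T X|lebesgue. b x \<bullet> Du x)"
proof -
  have Du: "continuous_on (closure \<Omega>) Du"
    using C2 by (auto simp: C2_on_def intro: has_derivative_continuous_on)
  have int: "set_integrable lebesgue (dual T X) (\<lambda>x. b x \<bullet> Du x)"
    by (intro set_integrable_continuous_compact compact_dual_mesh continuous_on_inner
        continuous_on_subset[OF _ dual_subset_closure] b Du)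
  have eq: "b x \<bullet> grad u x = b x \<bullet> Du x" if "x \<in> dual T X - frontier (closure \<Omega>)" for x
  proof -
    have x: "x \<in> interior (closure \<Omega>)" "x \<in> closure \<Omega>"
      using that dual_subset_closure by (auto simp: frontier_def)
    have "(u has_derivative (\<lambda>h. h \<bullet> Du x)) (at x within closure \<Omega>)"
      using C2 x(2) by (simp add: C2_on_def)
    then have "GDERIV u x :> Du x"
      unfolding at_within_interior[OF x(1)] gderiv_def .
    then show ?thesis by (simp add: grad_eqI)
  qed
  have int': "set_integrable lebesgue (dual T X) (\<lambda>x. b x \<bullet> grad u x)"
    by (rule absolutely_integrable_spike[OF int negligible_frontier_closure eq])
  have "Lc T b u X = integral (dual T X) (\<lambda>x. b x \<bullet> grad u x)"
    unfolding Lc_def by (rule set_lebesgue_integral_eq_integral(2)[OF int'])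
  also have "\<dots> = integral (dual T X) (\<lambda>x. b x \<bullet> Du x)"
    by (rule integral_spike[OF negligible_frontier_closure]) (simp add: eq)
  also have "\<dots> = (LINT x:dual T X|lebesgue. b x \<bullet> Du x)"
    by (rule set_lebesgue_integral_eq_integral(2)[OF int, symmetric])
  finally show ?thesis .
qed

lemma grad_lagrange_const:
  assumes "t \<in> T" "v \<in> t"
  shows "grad (lagrange t v) x = grad (lagrange t v) y"
  by (rule grad_eqI, rule lagrange_grad) (use assms mesh_triangle in auto)

lemma grad_ubar:
  assumes "t \<in> T"
  shows "grad (ubar T u X t \<beta>) x
    = (\<Sum>v\<in>t. ((1 + \<beta> v * (mesh_size T X)\<^sup>2) * u v) *\<^sub>R grad (lagrange t v) X)"
proof (rule grad_eqI)
  have "(lagrange t v has_derivative (\<lambda>h. h \<bullet> grad (lagrange t v) X)) (at x)" if "v \<in> t" for v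
    using lagrange_grad(1)[OF mesh_triangle[OF assms] that] by (simp add: gderiv_def)
  then have "((\<lambda>x. \<Sum>v\<in>t. ((1 + \<beta> v * (mesh_size T X)\<^sup>2) * u v) * lagrange t v x) has_derivative
      (\<lambda>h. \<Sum>v\<in>t. ((1 + \<beta> v * (mesh_size T X)\<^sup>2) * u v) * (h \<bullet> grad (lagrange t v) X))) (at x)"
    by (intro has_derivative_sum has_derivative_mult_right)
  then show "GDERIV (ubar T u X t \<beta>) x :>
      (\<Sum>v\<in>t. ((1 + \<beta> v * (mesh_size T X)\<^sup>2) * u v) *\<^sub>R grad (lagrange t v) X)"
    unfolding gderiv_def by (simp add: ubar_def[abs_def] inner_sum_right mult_ac)
qed

text \<open>The coefficients \<open>\<beta>\<close> enter the reconstruction linearly and its gradient is constant, so that their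
  contribution to \<open>Lc\<close> is exactly the second summand of the remainder. What is left does not depend on
  \<open>\<beta>\<close>.\<close>

lemma consistency_error_eq:
  assumes b: "continuous_on (closure \<Omega>) b" and C2: "C2_on (closure \<Omega>) u Du D2u" and t: "t \<in> T"
  shows "Lc T b (ubar T u X t \<beta>) X - Lc T b u X - remainder T b u D2u X t \<beta> =
    (LINT x:dual T X|lebesgue.
      b x \<bullet> ((\<Sum>v\<in>t. u v *\<^sub>R grad (lagrange t v) x) - Du x - grad_gtilde D2u X t x))" (is "_ = ?I")
    and "set_integrable lebesgue (dual T X) (\<lambda>x.
      b x \<bullet> ((\<Sum>v\<in>t. u v *\<^sub>R grad (lagrange t v) x) - Du x - grad_gtilde D2u X t x))" (is ?int)
proof -
  let ?D = "dual T X" and ?h = "mesh_size T X"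
  define G where "G v = grad (lagrange t v) X" for v
  have G: "grad (lagrange t v) x = G v" if "v \<in> t" for v x
    unfolding G_def by (rule grad_lagrange_const[OF t that])
  \<comment> \<open>\<open>a\<close> is the gradient of the unperturbed interpolant, \<open>d\<close> the part that comes from \<open>\<beta>\<close>.\<close>
  define a where "a = (\<Sum>v\<in>t. u v *\<^sub>R G v)"
  define d where "d = (\<Sum>v\<in>t. (?h\<^sup>2 * \<beta> v * u v) *\<^sub>R G v)"
  have a: "(\<Sum>v\<in>t. u v *\<^sub>R grad (lagrange t v) x) = a" for x
    unfolding a_def by (simp add: G)
  have grad_ubar: "grad (ubar T u X t \<beta>) x = a + d" for x
    unfolding grad_ubar[OF t] a_def d_def sum.distrib[symmetric]
    by (intro sum.cong refl) (simp add: G_def algebra_simps)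
  have Du: "continuous_on (closure \<Omega>) Du"
    using C2 by (auto simp: C2_on_def intro: has_derivative_continuous_on)
  have g: "grad_gtilde D2u X t = (\<lambda>x.
    (D2u X $ 1 $ 1 / 2) *\<^sub>R (\<Sum>v\<in>t. (v $ 1 - x $ 1)\<^sup>2 *\<^sub>R G v) +
     (D2u X $ 2 $ 2 / 2) *\<^sub>R (\<Sum>v\<in>t. (v $ 2 - x $ 2)\<^sup>2 *\<^sub>R G v) +
     (D2u X $ 1 $ 2) *\<^sub>R (\<Sum>v\<in>t. ((v $ 1 - x $ 1) * (v $ 2 - x $ 2)) *\<^sub>R G v))"
    unfolding grad_gtilde_def by (simp add: G)
  have cb: "continuous_on ?D b"
    by (rule continuous_on_subset[OF b dual_subset_closure])
  have int: "set_integrable lebesgue ?D (\<lambda>x. b x \<bullet> f x)" if "continuous_on ?D f" for f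
    using that cb by (intro set_integrable_continuous_compact compact_dual_mesh continuous_on_inner)
  have cDu: "continuous_on ?D Du"
    by (rule continuous_on_subset[OF Du dual_subset_closure])
  have cg: "continuous_on ?D (grad_gtilde D2u X t)"
    unfolding g by (intro continuous_intros)
  have ib: "set_integrable lebesgue ?D b"
    by (intro set_integrable_continuous_compact compact_dual_mesh cb)
  have const: "(LINT x:?D|lebesgue. b x \<bullet> w) = (LINT x:?D|lebesgue. b x) \<bullet> w" for w
    using ib unfolding set_lebesgue_integral_def set_integrable_def
    by (subst integral_inner_left[symmetric]) auto
  have "Lc T b (ubar T u X t \<beta>) X = (LINT x:?D|lebesgue. b x \<bullet> a) + (LINT x:?D|lebesgue. b x) \<bullet> d"
    unfolding Lc_def grad_ubar const by (simp add: inner_add_right)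
  moreover have "?h\<^sup>2 * (\<Sum>v\<in>t. \<beta> v * (G v \<bullet> (LINT x:?D|lebesgue. b x)) * u v)
      = (LINT x:?D|lebesgue. b x) \<bullet> d"
    unfolding d_def inner_sum_right sum_distrib_left
    by (intro sum.cong refl) (simp add: inner_commute)
  ultimately have "Lc T b (ubar T u X t \<beta>) X - Lc T b u X - remainder T b u D2u X t \<beta> =
      (LINT x:?D|lebesgue. b x \<bullet> a) - (LINT x:?D|lebesgue. b x \<bullet> Du x)
        - (LINT x:?D|lebesgue. b x \<bullet> grad_gtilde D2u X t x)"
    unfolding remainder_def Lc_C2[OF b C2] by (simp add: G_def)
  also have "\<dots> = ?I"
    unfolding a inner_diff_right
    using int[OF continuous_on_const[of _ a]] int[OF cDu] int[OF cg] by simp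
  finally show "Lc T b (ubar T u X t \<beta>) X - Lc T b u X - remainder T b u D2u X t \<beta> = ?I" .
  show ?int
    unfolding a by (intro int continuous_intros cDu cg)
qed

end

section \<open>Estimate of the consistency error\<close>

text \<open>Expanding the nodal values about \<open>X\<close> to second order, the affine parts reproduce \<open>Du X\<close> and the
  quadratic parts are those of \<open>grad_gtilde\<close>. What remains is the Taylor remainder of \<open>Du\<close> at \<open>x\<close> and the
  cubic remainders at the vertices, the latter multiplied by basis gradients of norm at most \<open>1 / r\<close>.
  Both remainders live on segments that start at \<open>X\<close>. Such segments stay in the domain, whereas one
  from \<open>x\<close> to a vertex of \<open>t\<close> may leave it if \<open>x\<close> lies in another triangle at \<open>X\<close>.\<close>

lemma upwind_gradient_error:
  assumes t: "card t = 3" "\<not> affine_dependent t" and X: "X \<in> t"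
    and r: "0 < r" "cball c r \<subseteq> convex hull t" "diameter (convex hull t) \<le> \<sigma> * r"
    and C2: "C2_on S u Du D2u" and L: "L-lipschitz_on S D2u" and sym: "transpose (D2u X) = D2u X"
    and seg: "\<And>v. v \<in> t \<Longrightarrow> closed_segment X v \<subseteq> S" "closed_segment X x \<subseteq> S"
    and h: "\<And>v. v \<in> t \<Longrightarrow> dist X v \<le> h" "dist X x \<le> h"
  shows "norm ((\<Sum>v\<in>t. u v *\<^sub>R grad (lagrange t v) x) - Du x - grad_gtilde D2u X t x)
    \<le> L * (1 + 3 * \<sigma>) * h\<^sup>2"
proof -
  have "finite t" using t(1) card.infinite by fastforce
  define G where "G v = grad (lagrange t v) x" for v
  define Q where "Q v = (v - X) \<bullet> (D2u X *v (v - X)) / 2" for v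
  define R where "R v = u v - u X - (v - X) \<bullet> Du X - Q v" for v
  have L0: "0 \<le> L" using L by (rule lipschitz_on_nonneg)
  have h0: "0 \<le> h" using h(2) zero_le_dist[of X x] by linarith
  have R: "norm (R v *\<^sub>R G v) \<le> \<sigma> * L * h\<^sup>2" if v: "v \<in> t" for v
  proof -
    have "\<bar>R v\<bar> \<le> L * norm (v - X) ^ 3"
      unfolding R_def Q_def by (rule C2_on_taylor[OF C2 L seg(1)[OF v] sym])
    moreover have "norm (G v) \<le> 1 / r"
      unfolding G_def by (rule norm_grad_lagrange_le[OF t v r(1,2)])
    ultimately have "norm (R v *\<^sub>R G v) \<le> (L * norm (v - X) ^ 3) * (1 / r)"
      unfolding norm_scaleR by (intro mult_mono) (auto simp: L0)
    also have "\<dots> = L * norm (v - X) ^ 2 * (norm (v - X) / r)"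
      by (simp add: power2_eq_square power3_eq_cube)
    also have "\<dots> \<le> L * h ^ 2 * \<sigma>"
    proof (rule mult_mono)
      show "L * norm (v - X) ^ 2 \<le> L * h ^ 2"
        using h(1)[OF v] L0 by (intro mult_left_mono power_mono) (auto simp: dist_norm norm_minus_commute)
      \<comment> \<open>One of the three factors of the cubic remainder is measured against the diameter of \<open>t\<close> itself, not
    against \<open>h\<close>: the triangles at \<open>X\<close> may have very different sizes.\<close>
      have "bounded (convex hull t)"
        using \<open>finite t\<close> by (simp add: finite_imp_bounded bounded_convex_hull)
      then have "dist v X \<le> diameter (convex hull t)"
        using v X by (intro diameter_bounded_bound) (auto intro: hull_inc)
      then show "norm (v - X) / r \<le> \<sigma>"
        using r(1,3) by (simp add: dist_norm divide_le_eq)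
    qed (use L0 r(1) in auto)
    finally show ?thesis by (simp add: mult_ac)
  qed
  \<comment> \<open>The first-order Taylor polynomial is affine, so its interpolant has gradient \<open>Du X\<close>.\<close>
  have aff: "(\<Sum>v\<in>t. (u X + (v - X) \<bullet> Du X) *\<^sub>R G v) = Du X"
  proof -
    have "u X + (v - X) \<bullet> Du X = Du X \<bullet> v + (u X - Du X \<bullet> X)" for v
      by (simp add: inner_diff_left inner_commute[of "Du X"])
    then show ?thesis
      unfolding G_def by (simp only: lagrange_reproduces_affine[OF t])
  qed
  have "(\<Sum>v\<in>t. u v *\<^sub>R G v) = (\<Sum>v\<in>t. (u X + (v - X) \<bullet> Du X) *\<^sub>R G v + Q v *\<^sub>R G v + R v *\<^sub>R G v)"
    by (intro sum.cong refl) (simp add: R_def scaleR_add_left[symmetric])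
  also have "\<dots> = Du X + (\<Sum>v\<in>t. Q v *\<^sub>R G v) + (\<Sum>v\<in>t. R v *\<^sub>R G v)"
    by (simp only: sum.distrib aff)
  finally have split: "(\<Sum>v\<in>t. u v *\<^sub>R G v) - Du x - grad_gtilde D2u X t x
      = (\<Sum>v\<in>t. R v *\<^sub>R G v) - (Du x - Du X - D2u X *v (x - X))"
    unfolding grad_gtilde_eq[OF t, where D2u = D2u and X = X, OF sym] by (simp add: G_def Q_def)
  have "norm (\<Sum>v\<in>t. R v *\<^sub>R G v) \<le> 3 * (\<sigma> * L * h\<^sup>2)"
    using sum_norm_bound[of t "\<lambda>v. R v *\<^sub>R G v" "\<sigma> * L * h\<^sup>2"] R t(1) by simp
  moreover have "norm (Du x - Du X - D2u X *v (x - X)) \<le> L * h\<^sup>2"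
  proof -
    have "norm (Du x - Du X - D2u X *v (x - X)) \<le> L * norm (x - X) ^ 2"
      by (rule C2_on_taylor_gradient[OF C2 L seg(2)])
    also have "\<dots> \<le> L * h\<^sup>2"
      using h(2) L0 by (intro mult_left_mono power_mono) (auto simp: dist_norm norm_minus_commute)
    finally show ?thesis .
  qed
  ultimately have "norm ((\<Sum>v\<in>t. u v *\<^sub>R G v) - Du x - grad_gtilde D2u X t x)
      \<le> 3 * (\<sigma> * L * h\<^sup>2) + L * h\<^sup>2"
    unfolding split
    using norm_triangle_ineq4[of "\<Sum>v\<in>t. R v *\<^sub>R G v" "Du x - Du X - D2u X *v (x - X)"]
    by linarith
  then show ?thesis by (simp add: G_def algebra_simps)
qed

lemma set_integral_norm_bound_const:
  fixes f :: "'a \<Rightarrow> 'b::{banach, second_countable_topology}"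
  assumes f: "set_integrable M A f" and A: "A \<in> fmeasurable M"
    and B: "\<And>x. x \<in> A \<Longrightarrow> norm (f x) \<le> B"
  shows "norm (LINT x:A|M. f x) \<le> B * measure M A"
proof -
  have "norm (LINT x:A|M. f x) \<le> (LINT x:A|M. norm (f x))"
    by (rule set_integral_norm_bound[OF f])
  also have "\<dots> \<le> (LINT x:A|M. B)"
    using f A B by (intro set_integral_mono set_integrable_norm)
      (auto simp: set_integrable_def fmeasurable_def)
  also have "\<dots> = B * measure M A"
    using A by (simp add: set_lebesgue_integral_def fmeasurable_def)
  finally show ?thesis .
qed

text \<open>Two powers of the mesh size come from the pointwise error, two from the area of the control
  volume.\<close>

lemma consistency_error_bound:
  assumes mesh: "triangular_mesh \<Omega> T" and "open \<Omega>" and reg: "shape_regular \<sigma> T"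
    and b: "continuous_on (closure \<Omega>) b" "\<And>x. x \<in> closure \<Omega> \<Longrightarrow> norm (b x) \<le> B"
    and C2: "C2_on (closure \<Omega>) u Du D2u" and L: "L-lipschitz_on (closure \<Omega>) D2u"
    and t: "t \<in> T" "X \<in> t"
  shows "\<bar>Lc T b (ubar T u X t \<beta>) X - Lc T b u X - remainder T b u D2u X t \<beta>\<bar>
    \<le> B * (L * (1 + 3 * \<sigma>)) * pi * mesh_size T X ^ 4"
proof -
  let ?h = "mesh_size T X"
  note tri = mesh_triangle[OF mesh t(1)]
  obtain c r where r: "0 < r" "cball c r \<subseteq> convex hull t" "diameter (convex hull t) \<le> \<sigma> * r"
    using reg t(1) by (auto simp: shape_regular_def)
  have X: "X \<in> convex hull t" using t(2) by (rule hull_inc)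
  then have "X \<in> closure \<Omega>" using mesh_covers[OF mesh] t(1) by blast
  then have sym: "transpose (D2u X) = D2u X"
    by (rule C2_on_symmetric_hessian[OF \<open>open \<Omega>\<close> C2])
  have B0: "0 \<le> B" using b(2)[OF \<open>X \<in> closure \<Omega>\<close>] norm_ge_zero order_trans by blast
  have \<sigma>0: "0 \<le> \<sigma>"
  proof -
    have "0 \<le> diameter (convex hull t)"
      using mesh_triangle_finite[OF mesh t(1)]
      by (intro diameter_ge_0) (simp add: finite_imp_bounded bounded_convex_hull)
    then have "0 \<le> \<sigma> * r" using r(3) by linarith
    then show ?thesis using r(1) by (simp add: zero_le_mult_iff)
  qed
  have L0: "0 \<le> L" using L by (rule lipschitz_on_nonneg)
  define e where "e x = (\<Sum>v\<in>t. u v *\<^sub>R grad (lagrange t v) x) - Du x - grad_gtilde D2u X t x" for x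
  have e: "norm (e x) \<le> L * (1 + 3 * \<sigma>) * ?h\<^sup>2" if x: "x \<in> dual T X" for x
    unfolding e_def
  proof (rule upwind_gradient_error[OF tri t(2) r C2 L sym])
    fix v assume v: "v \<in> t"
    show "closed_segment X v \<subseteq> closure \<Omega>"
      using segment_in_closure[OF mesh t(1) X] v by (simp add: hull_inc)
    show "dist X v \<le> ?h"
      using dist_le_mesh_size[OF mesh_finite[OF mesh] mesh_triangle_finite[OF mesh] t t(2) v] by simp
  next
    obtain s where "s \<in> T" "X \<in> s" "x \<in> convex hull s"
      using dual_subset_hulls[OF mesh] x by blast
    then show "closed_segment X x \<subseteq> closure \<Omega>"
      using segment_in_closure[OF mesh] by (simp add: hull_inc)
    show "dist X x \<le> ?h"
      using subsetD[OF dual_subset_cball[OF mesh] x] by simp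
  qed
  have be: "norm (b x \<bullet> e x) \<le> B * (L * (1 + 3 * \<sigma>) * ?h\<^sup>2)" if x: "x \<in> dual T X" for x
  proof -
    have "norm (b x \<bullet> e x) \<le> norm (b x) * norm (e x)"
      by (simp add: Cauchy_Schwarz_ineq2)
    also have "\<dots> \<le> B * (L * (1 + 3 * \<sigma>) * ?h\<^sup>2)"
      using x dual_subset_closure[OF mesh] b(2) e B0 by (intro mult_mono) auto
    finally show ?thesis .
  qed
  have "\<bar>Lc T b (ubar T u X t \<beta>) X - Lc T b u X - remainder T b u D2u X t \<beta>\<bar>
      = norm (LINT x:dual T X|lebesgue. b x \<bullet> e x)"
    unfolding consistency_error_eq(1)[OF mesh b(1) C2 t(1)] e_def by simp
  also have "\<dots> \<le> B * (L * (1 + 3 * \<sigma>) * ?h\<^sup>2) * measure lebesgue (dual T X)"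
    using consistency_error_eq(2)[OF mesh b(1) C2 t(1)] be compact_dual_mesh[OF mesh]
    by (intro set_integral_norm_bound_const) (auto simp: e_def lmeasurable_compact)
  also have "\<dots> \<le> B * (L * (1 + 3 * \<sigma>) * ?h\<^sup>2) * (pi * ?h\<^sup>2)"
    using measure_dual_le[OF mesh] t B0 L0 \<sigma>0 by (intro mult_left_mono) auto
  also have "\<dots> = B * (L * (1 + 3 * \<sigma>)) * pi * ?h ^ 4"
    by (simp add: power2_eq_square power4_eq_xxxx)
  finally show ?thesis .
qed

theorem theorem1:
  fixes \<Omega> :: "(real^2) set" and \<kappa> :: "real^2 \<Rightarrow> real^2^2" and b :: "real^2 \<Rightarrow> real^2"
    and f g u :: "real^2 \<Rightarrow> real" and Du :: "real^2 \<Rightarrow> real^2" and D2u :: "real^2 \<Rightarrow> real^2^2"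
  assumes domain: "open \<Omega>" "bounded \<Omega>"
    and kappa: "diffusion_tensor \<Omega> \<kappa>"
    and b: "\<And>j. W1inf \<Omega> (\<lambda>x. b x $ j)" "continuous_on (closure \<Omega>) b"
    and f: "L2 \<Omega> f"
    and solution: "solves \<Omega> \<kappa> b f g u"
    and C2: "C2_on (closure \<Omega>) u Du D2u"
  shows "(\<forall>T. triangular_mesh \<Omega> T \<longrightarrow>
            (\<exists>C. \<forall>X\<in>\<Union>T. \<forall>t. upwind_triangle T b X t \<longrightarrow> (\<forall>\<beta>.
               \<bar>(Lc T b (ubar T u X t \<beta>) X - Lc T b u X) - remainder T b u D2u X t \<beta>\<bar>
                 \<le> C * mesh_size T X ^ 4)))
       \<and> ((\<exists>L. L-lipschitz_on (closure \<Omega>) D2u) \<longrightarrow>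
            (\<forall>\<sigma>. \<exists>C. \<forall>T. triangular_mesh \<Omega> T \<and> shape_regular \<sigma> T \<longrightarrow>
              (\<forall>X\<in>\<Union>T. \<forall>t. upwind_triangle T b X t \<longrightarrow> (\<forall>\<beta>.
               \<bar>(Lc T b (ubar T u X t \<beta>) X - Lc T b u X) - remainder T b u D2u X t \<beta>\<bar>
                 \<le> C * mesh_size T X ^ 4))))"
proof (intro conjI allI impI)
  fix T assume mesh: "triangular_mesh \<Omega> T"
  define I where "I X t = (LINT x:dual T X|lebesgue.
    b x \<bullet> ((\<Sum>v\<in>t. u v *\<^sub>R grad (lagrange t v) x) - Du x - grad_gtilde D2u X t x))" for X t
  define P where "P = {(X, t). t \<in> T \<and> X \<in> t}"
  \<comment> \<open>On a single mesh the error takes finitely many values, because it depends only on the node and the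
    triangle, and the mesh size is positive at every node. Summing the quotients gives a constant.\<close>
  define C where "C = (\<Sum>(X, t)\<in>P. \<bar>I X t\<bar> / mesh_size T X ^ 4)"
  have finP: "finite P"
  proof (rule finite_subset)
    show "P \<subseteq> \<Union>T \<times> T" by (auto simp: P_def)
    show "finite (\<Union>T \<times> T)"
      using mesh_finite[OF mesh] mesh_triangle_finite[OF mesh] by auto
  qed
  show "\<exists>C. \<forall>X\<in>\<Union>T. \<forall>t. upwind_triangle T b X t \<longrightarrow> (\<forall>\<beta>.
      \<bar>(Lc T b (ubar T u X t \<beta>) X - Lc T b u X) - remainder T b u D2u X t \<beta>\<bar>
        \<le> C * mesh_size T X ^ 4)"
  proof (intro exI[of _ C] ballI allI impI)
    fix X t \<beta> assume "upwind_triangle T b X t"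
    then have t: "t \<in> T" "X \<in> t" by (auto simp: upwind_triangle_def)
    have h: "0 < mesh_size T X"
    proof -
      have "t \<noteq> {X}" using mesh_triangle(1)[OF mesh t(1)] by auto
      then obtain v where "v \<in> t" "v \<noteq> X" using t(2) by blast
      then show ?thesis
        using dist_le_mesh_size[OF mesh_finite[OF mesh] mesh_triangle_finite[OF mesh] t t(2), of v]
        by (metis dist_pos_lt order_less_le_trans)
    qed
    have "\<bar>I X t\<bar> / mesh_size T X ^ 4 \<le> C"
    proof -
      have "(X, t) \<in> P" using t by (simp add: P_def)
      from member_le_sum[OF this, of "\<lambda>(X, t). \<bar>I X t\<bar> / mesh_size T X ^ 4"] finP
      show ?thesis by (simp add: C_def split_beta)
    qed
    then have "\<bar>I X t\<bar> \<le> C * mesh_size T X ^ 4"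
      using h by (simp add: divide_le_eq)
    then show "\<bar>(Lc T b (ubar T u X t \<beta>) X - Lc T b u X) - remainder T b u D2u X t \<beta>\<bar>
        \<le> C * mesh_size T X ^ 4"
      unfolding consistency_error_eq(1)[OF mesh b(2) C2 t(1)] I_def .
  qed
next
  fix \<sigma> assume "\<exists>L. L-lipschitz_on (closure \<Omega>) D2u"
  then obtain L where L: "L-lipschitz_on (closure \<Omega>) D2u" by blast
  have "compact (b ` closure \<Omega>)"
    using domain(2) b(2) by (intro compact_continuous_image) auto
  then have "bounded (b ` closure \<Omega>)"
    by (rule compact_imp_bounded)
  then obtain B where "\<forall>y\<in>b ` closure \<Omega>. norm y \<le> B"
    unfolding bounded_iff by blast
  then have B: "\<And>x. x \<in> closure \<Omega> \<Longrightarrow> norm (b x) \<le> B"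
    by simp
  show "\<exists>C. \<forall>T. triangular_mesh \<Omega> T \<and> shape_regular \<sigma> T \<longrightarrow>
      (\<forall>X\<in>\<Union>T. \<forall>t. upwind_triangle T b X t \<longrightarrow> (\<forall>\<beta>.
        \<bar>(Lc T b (ubar T u X t \<beta>) X - Lc T b u X) - remainder T b u D2u X t \<beta>\<bar>
          \<le> C * mesh_size T X ^ 4))"
  proof (intro exI[of _ "B * (L * (1 + 3 * \<sigma>)) * pi"] allI impI ballI)
    fix T X t \<beta> assume "triangular_mesh \<Omega> T \<and> shape_regular \<sigma> T" "upwind_triangle T b X t"
    then have mesh: "triangular_mesh \<Omega> T" and reg: "shape_regular \<sigma> T" and t: "t \<in> T" "X \<in> t"
      by (simp_all add: upwind_triangle_def)
    show "\<bar>(Lc T b (ubar T u X t \<beta>) X - Lc T b u X) - remainder T b u D2u X t \<beta>\<bar>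
        \<le> B * (L * (1 + 3 * \<sigma>)) * pi * mesh_size T X ^ 4"
      by (rule consistency_error_bound[OF mesh domain(1) reg b(2) B C2 L t])
  qed
qed

end
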